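(* Let $n\ge 1$, let $\mathcal M=\{u_1,\ldots,u_m\}\subset T_n$ be a set of monomials, and write $u_i=\prod_{j=1}^n x_j^{a_{i,j}}$ for $1\le i\le m$. Let $d>0$ be an integer with $\deg(u_i)\le d$ for all $i$. The following are equivalent: (1) $\mathcal M$ is smoothly spreadable. (2) For all $1\le i<\ell\le m$ and all $1\le j\le n$, $$\min\{a_{i,j},a_{\ell,j}\}=|A_{i,j}\cap A_{\ell,j}|,$$ where for $1\le i\le m$ and $1\le j\le n$ $$A_{i,j}:=\{(a_{i,1}+\cdots+a_{i,j-1})n+j,\ (a_{i,1}+\cdots+a_{i,j-1}+1)n+j,\ \ldots,\ (a_{i,1}+\cdots+a_{i,j}-1)n+j\}$$ (so $A_{i,j}$ has $a_{i,j}$ elements, and is empty if $a_{i,j}=0$).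
   Context: $K$ is a field, $T=K[x_1,x_2,\ldots]$ and $T_n=K[x_1,\ldots,x_n]$. For a monomial $u=x_{i_1}x_{i_2}\cdots x_{i_d}$ with $i_1\le i_2\le\cdots\le i_d$, set $\sigma(u):=x_{i_1}x_{i_2+1}\cdots x_{i_d+d-1}$, and $\sigma^t(u):=\sigma(\sigma^{t-1}(u))$, so that $\sigma^t(u)=x_{i_1}x_{i_2+t}\cdots x_{i_d+(d-1)t}$. For a monomial $u=x_1^{a_1}\cdots x_n^{a_n}\in T_n$, its polarization (with respect to $T_n$) is $u^p:=\prod_{j=1}^n\prod_{k=0}^{a_j-1}x_{kn+j}$. Smoothly spreadable: let $d,m>0$ be integers and let $\mathcal M=\{u_1,\ldots,u_m\}\subset T_n$ be a set of monomials with $\deg(u_i)\le d$ for all $i$. $\mathcal M$ is smoothly spreadable if there is a permutation $\tau$ of $\{1,2,\ldots,nd\}$ with $\tau(j)\equiv j \pmod n$ for all $j$ such that the $K$-algebra isomorphism $\Phi:T_{nd}\to T_{nd}$, $\Phi(x_j)=x_{\tau(j)}$, satisfies $\Phi(\sigma^n(u_i))=u_i^p$ for all $1\le i\le m$. *)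

theory Defs
  imports
    "HOL-Library.Poly_Mapping"
    "HOL-Library.Multiset"
    "HOL-Combinatorics.Permutations"
    "HOL-Number_Theory.Cong"
begin

text \<open>
  Polynomials are finitely supported maps from exponent vectors to coefficients, with the
  convolution product of \<^theory>\<open>HOL-Library.Poly_Mapping\<close>. The variables are
  \<open>x\<^sub>1, x\<^sub>2, \<dots>\<close>; the index 0 exists in the type but is excluded from every \<open>poly_ring n\<close>.
  Monomials are ring elements, namely the products of variables.
\<close>

type_synonym 'k polynomial = "(nat \<Rightarrow>\<^sub>0 nat) \<Rightarrow>\<^sub>0 'k"

definition X :: "nat \<Rightarrow> 'k::field polynomial" where
  "X i = Poly_Mapping.single (Poly_Mapping.single i 1) 1"

definition const :: "'k::field \<Rightarrow> 'k polynomial" where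
  "const c = Poly_Mapping.single 0 c"

definition poly_ring :: "nat \<Rightarrow> 'k::field polynomial set" where
  "poly_ring n = {p. \<forall>e \<in> Poly_Mapping.keys p. Poly_Mapping.keys e \<subseteq> {1..n}}"

text \<open>The definitions from \<open>exponents\<close> to \<open>polarization\<close> are meaningful for monomials only.\<close>

definition exponents :: "'k::field polynomial \<Rightarrow> nat \<Rightarrow>\<^sub>0 nat" where
  "exponents u = (THE e. u = Poly_Mapping.single e 1)"

definition exponent :: "'k::field polynomial \<Rightarrow> nat \<Rightarrow> nat" where
  "exponent u j = Poly_Mapping.lookup (exponents u) j"

definition monomial_degree :: "'k::field polynomial \<Rightarrow> nat" where
  "monomial_degree u = (\<Sum>j \<in> Poly_Mapping.keys (exponents u). exponent u j)"

text \<open>The list \<open>[i\<^sub>1, \<dots>, i\<^sub>d]\<close> with \<open>i\<^sub>1 \<le> \<dots> \<le> i\<^sub>d\<close> and \<open>u = x\<^bsub>i\<^sub>1\<^esub> \<cdots> x\<^bsub>i\<^sub>d\<^esub>\<close>;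
  see \<open>index_list_prod\<close> below.\<close>

definition index_list :: "'k::field polynomial \<Rightarrow> nat list" where
  "index_list u = sorted_list_of_multiset
     (\<Sum>j \<in> Poly_Mapping.keys (exponents u). replicate_mset (exponent u j) j)"

text \<open>Positions in the list are counted from 0, so position \<open>k\<close> is shifted by \<open>k\<close>.\<close>

definition \<sigma> :: "'k::field polynomial \<Rightarrow> 'k polynomial" where
  "\<sigma> u = (\<Prod>k < length (index_list u). X (index_list u ! k + k))"

definition polarization :: "nat \<Rightarrow> 'k::field polynomial \<Rightarrow> 'k polynomial" where
  "polarization n u = (\<Prod>j = 1..n. \<Prod>k < exponent u j. X (k * n + j))"

definition algebra_automorphism ::
  "nat \<Rightarrow> ('k::field polynomial \<Rightarrow> 'k polynomial) \<Rightarrow> bool" where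
  "algebra_automorphism N \<Phi> \<longleftrightarrow>
     bij_betw \<Phi> (poly_ring N) (poly_ring N) \<and>
     \<Phi> 1 = 1 \<and>
     (\<forall>p \<in> poly_ring N. \<forall>q \<in> poly_ring N. \<Phi> (p + q) = \<Phi> p + \<Phi> q) \<and>
     (\<forall>p \<in> poly_ring N. \<forall>q \<in> poly_ring N. \<Phi> (p * q) = \<Phi> p * \<Phi> q) \<and>
     (\<forall>c. \<forall>p \<in> poly_ring N. \<Phi> (const c * p) = const c * \<Phi> p)"

text \<open>
  To be used for a nonempty finite set \<open>M\<close> of monomials of \<open>poly_ring n\<close> of degree at most
  \<open>d\<close>, with \<open>d > 0\<close>. Then \<open>\<sigma>\<^sup>n(u)\<close> and the polarization of \<open>u\<close> lie in \<open>poly_ring (n * d)\<close>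
  for \<open>u \<in> M\<close>. On \<open>poly_ring (n * d)\<close>, \<open>\<Phi>\<close> is uniquely determined by \<open>\<tau>\<close>.
\<close>

definition smoothly_spreadable :: "nat \<Rightarrow> nat \<Rightarrow> 'k::field polynomial set \<Rightarrow> bool" where
  "smoothly_spreadable n d M \<longleftrightarrow>
     (\<exists>\<tau> \<Phi>. \<tau> permutes {1..n * d} \<and> (\<forall>j \<in> {1..n * d}. [\<tau> j = j] (mod n)) \<and>
        algebra_automorphism (n * d) \<Phi> \<and> (\<forall>j \<in> {1..n * d}. \<Phi> (X j) = X (\<tau> j)) \<and>
        (\<forall>u \<in> M. \<Phi> ((\<sigma> ^^ n) u) = polarization n u))"

text \<open>\<open>A\<^bsub>i,j\<^esub>\<close> for the exponent sequence \<open>b = (a\<^bsub>i,1\<^esub>, \<dots>, a\<^bsub>i,n\<^esub>)\<close>.\<close>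

definition A_set :: "nat \<Rightarrow> (nat \<Rightarrow> nat) \<Rightarrow> nat \<Rightarrow> nat set" where
  "A_set n b j = (\<lambda>k. k * n + j) ` {(\<Sum>l = 1..<j. b l) ..< (\<Sum>l = 1..j. b l)}"

lemma exponents_single:
  "exponents (Poly_Mapping.single e 1 :: 'k::field polynomial) = e"
proof -
  have "Poly_Mapping.single e (1::'k) = Poly_Mapping.single e' 1 \<Longrightarrow> e' = e" for e'
    by (metis keys_single singleton_insert_inj_eq' zero_neq_one)
  then show ?thesis
    unfolding exponents_def by blast
qed

lemma prod_list_X:
  "prod_list (map X xs) =
     (Poly_Mapping.single (\<Sum>i\<leftarrow>xs. Poly_Mapping.single i 1) 1 :: 'k::field polynomial)"
  by (induction xs) (simp_all add: X_def mult_single single_one)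

lemma lookup_sum_list_single:
  "Poly_Mapping.lookup (\<Sum>i\<leftarrow>xs. Poly_Mapping.single i (1::nat)) j = count (mset xs) j"
  by (induction xs) (auto simp: lookup_add lookup_single when_def)

lemma index_list_prod:
  assumes "sorted xs"
  shows "index_list (prod_list (map X xs) :: 'k::field polynomial) = xs"
proof -
  let ?e = "\<Sum>i\<leftarrow>xs. Poly_Mapping.single i (1::nat)"
  have "count (\<Sum>j \<in> Poly_Mapping.keys ?e.
      replicate_mset (Poly_Mapping.lookup ?e j) j) x = count (mset xs) x" for x
    by (simp add: count_sum in_keys_iff lookup_sum_list_single [unfolded One_nat_def])
  then have "(\<Sum>j \<in> Poly_Mapping.keys ?e.
      replicate_mset (Poly_Mapping.lookup ?e j) j) = mset xs"
    by (rule multiset_eqI)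
  then show ?thesis
    using assms
    by (simp add: index_list_def exponent_def prod_list_X exponents_single sorted_sort_id)
qed

end

theory Submission
  imports Defs
begin

text \<open>
  The idea is to reduce both conditions to statements about index sets. In the sorted list of
  indices of \<open>u = x\<^sub>1\<^bsup>a\<^sub>1\<^esup> \<cdots> x\<^sub>n\<^bsup>a\<^sub>n\<^esup>\<close>, counted from 0, the index \<open>j\<close> occupies the positions
  \<open>k\<close> with \<open>a\<^sub>1 + \<cdots> + a\<^bsub>j-1\<^esub> \<le> k < a\<^sub>1 + \<cdots> + a\<^sub>j\<close>, and \<open>\<sigma>\<^sup>n\<close> moves the entry at position \<open>k\<close> to
  \<open>kn + j\<close>. So \<open>\<sigma>\<^sup>n(u)\<close> is squarefree, and the indices of its variables congruent to \<open>j\<close> modulo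
  \<open>n\<close> form exactly the set \<open>A\<^sub>j\<close> of \<open>u\<close> (\<open>sigma_power_monomial\<close>). The polarization is squarefree
  too, and its indices in this class are the initial segment \<open>{kn + j | k < a\<^sub>j}\<close>
  (\<open>polarization_monomial\<close>). An algebra map with \<open>x\<^sub>j \<mapsto> x\<^bsub>\<tau>(j)\<^esub>\<close> acts on squarefree monomials by
  taking images of index sets under \<open>\<tau>\<close>, and \<open>\<tau>\<close> keeps every residue class. Hence it sends
  \<open>\<sigma>\<^sup>n(u)\<close> to the polarization of \<open>u\<close> if and only if \<open>\<tau>\<close> maps each \<open>A\<^sub>j\<close> onto that initial segment
  (\<open>spread_to_polarization_iff\<close>). Conversely, every permutation of the variables comes from
  an algebra automorphism (\<open>algebra_automorphism_rename_vars\<close>).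

  It remains to see when one permutation, acting separately on each residue class,
  straightens all the sets \<open>A\<^bsub>i,j\<^esub>\<close> into initial segments (\<open>straightening_permutation_iff\<close>). If it
  exists, then \<open>A\<^bsub>i,j\<^esub> \<inter> A\<^bsub>l,j\<^esub>\<close> has as many elements as the intersection of two initial segments,
  which is the smaller of their sizes. If conversely every intersection is as large as the smaller
  of its two sets, then for fixed \<open>j\<close> the sets \<open>A\<^bsub>i,j\<^esub>\<close> form a chain
  (\<open>card_Int_eq_min_iff_nested\<close>). A chain of finite sets can be straightened by enumerating its
  smallest member first, then what the next one adds, and so on (\<open>chain_enumeration\<close>); the
  enumerations for the \<open>n\<close> residue classes are glued by \<open>blockwise_permutation\<close>.
\<close>

section \<open>Renaming variables\<close>

lemma poly_mapping_single_plus_induct: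
  assumes "P 0" and "\<And>f a b. P f \<Longrightarrow> P (Poly_Mapping.single a b + f)"
  shows "P (f :: 'a \<Rightarrow>\<^sub>0 'b::comm_monoid_add)"
proof (induction f rule: update_induct)
  case const
  then show ?case by (rule assms(1))
next
  case (update f a b)
  have "Poly_Mapping.update a b f = Poly_Mapping.single a b + f"
    by (rule poly_mapping_eqI)
      (use update(1) in \<open>auto simp: lookup_update lookup_add lookup_single when_def in_keys_iff\<close>)
  then show ?case
    using assms(2)[OF update(3)] by simp
qed

text \<open>
  The algebra map \<open>x\<^sub>i \<mapsto> x\<^bsub>\<tau>(i)\<^esub>\<close>, for a bijection \<open>\<tau>\<close>. The inner \<open>map_key\<close> turns an exponent vector
  \<open>e\<close> into \<open>e \<circ> \<tau>\<close>; the coefficient of the new polynomial at \<open>e\<close> is the old one at \<open>e \<circ> \<tau>\<close>.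
\<close>

definition rename_vars :: "(nat \<Rightarrow> nat) \<Rightarrow> 'k::field polynomial \<Rightarrow> 'k polynomial" where
  "rename_vars \<tau> = Poly_Mapping.map_key (Poly_Mapping.map_key \<tau>)"

lemma map_key_inverse:
  assumes "bij \<tau>"
  shows "Poly_Mapping.map_key (inv \<tau>) (Poly_Mapping.map_key \<tau> e) = e"
    and "Poly_Mapping.map_key \<tau> (Poly_Mapping.map_key (inv \<tau>) e) = e"
proof -
  have "inj \<tau>" "inj (inv \<tau>)" "\<tau> \<circ> inv \<tau> = (\<lambda>x. x)" "inv \<tau> \<circ> \<tau> = (\<lambda>x. x)"
    using assms bij_imp_bij_inv[OF assms]
    by (auto simp: bij_is_inj fun_eq_iff bij_is_surj surj_f_inv_f)
  then show "Poly_Mapping.map_key (inv \<tau>) (Poly_Mapping.map_key \<tau> e) = e"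
    and "Poly_Mapping.map_key \<tau> (Poly_Mapping.map_key (inv \<tau>) e) = e"
    by (simp_all only: map_key_compose map_key_id)
qed

lemma inj_map_key:
  fixes \<tau> :: "'a \<Rightarrow> 'a"
  assumes "bij \<tau>"
  shows "inj (Poly_Mapping.map_key \<tau>)"
  by (rule inj_on_inverseI) (rule map_key_inverse(1)[OF assms])

lemma rename_vars_add:
  assumes "bij \<tau>"
  shows "rename_vars \<tau> (p + q) = rename_vars \<tau> p + rename_vars \<tau> q"
  unfolding rename_vars_def by (rule map_key_plus[OF inj_map_key[OF assms]])

lemma rename_vars_single:
  assumes "bij \<tau>"
  shows "rename_vars \<tau> (Poly_Mapping.single e c) =
    Poly_Mapping.single (Poly_Mapping.map_key (inv \<tau>) e) c"
  using map_key_single[OF inj_map_key[OF assms], of "Poly_Mapping.map_key (inv \<tau>) e" c]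
  by (simp add: rename_vars_def map_key_inverse[OF assms])

lemma rename_vars_zero: "bij \<tau> \<Longrightarrow> rename_vars \<tau> 0 = 0"
  unfolding rename_vars_def by (rule map_key_zero[OF inj_map_key])

text \<open>
  By additivity in both factors, it suffices to multiply two terms, whose exponent vectors add.
\<close>

lemma rename_vars_mult:
  assumes "bij \<tau>"
  shows "rename_vars \<tau> (p * q) = rename_vars \<tau> p * rename_vars \<tau> q"
proof (induction p rule: poly_mapping_single_plus_induct)
  case 1
  then show ?case by (simp add: rename_vars_zero[OF assms])
next
  case (2 p e c)
  have "rename_vars \<tau> (Poly_Mapping.single e c * q) =
      rename_vars \<tau> (Poly_Mapping.single e c) * rename_vars \<tau> q"
  proof (induction q rule: poly_mapping_single_plus_induct)
    case 1
    then show ?case by (simp add: rename_vars_zero[OF assms])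
  next
    case (2 q e' c')
    then show ?case
      by (simp add: distrib_left rename_vars_add[OF assms] mult_single
          rename_vars_single[OF assms] map_key_plus[OF bij_is_inj[OF bij_imp_bij_inv[OF assms]]])
  qed
  then show ?case
    using 2 by (simp add: distrib_right rename_vars_add[OF assms])
qed

lemma rename_vars_const:
  assumes "bij \<tau>"
  shows "rename_vars \<tau> (const c) = const c"
  by (simp add: const_def rename_vars_single[OF assms]
      map_key_zero[OF bij_is_inj[OF bij_imp_bij_inv[OF assms]]])

lemma rename_vars_X:
  assumes "bij \<tau>"
  shows "rename_vars \<tau> (X i) = X (\<tau> i)"
proof -
  have "Poly_Mapping.map_key (inv \<tau>) (Poly_Mapping.single (inv \<tau> (\<tau> i)) (1::nat)) =
      Poly_Mapping.single (\<tau> i) 1"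
    by (rule map_key_single[OF bij_is_inj[OF bij_imp_bij_inv[OF assms]]])
  then show ?thesis
    by (simp add: X_def rename_vars_single[OF assms] bij_is_inj[OF assms])
qed

lemma rename_vars_inverse:
  assumes "bij \<tau>"
  shows "rename_vars (inv \<tau>) (rename_vars \<tau> p) = p"
proof -
  have "Poly_Mapping.map_key \<tau> \<circ> Poly_Mapping.map_key (inv \<tau>) = (\<lambda>e :: nat \<Rightarrow>\<^sub>0 nat. e)"
    by (simp add: fun_eq_iff map_key_inverse[OF assms])
  then show ?thesis
    unfolding rename_vars_def
    by (simp add: map_key_compose inj_map_key assms bij_imp_bij_inv map_key_id)
qed

text \<open>
  A permutation of \<open>{1..N}\<close> fixes all other indices, so no variable can leave the range. This makes
  the restriction to \<open>poly_ring N\<close> bijective: the inverse permutation gives the inverse map.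
\<close>

lemma rename_vars_in_poly_ring:
  assumes "\<tau> permutes {1..N}" and "p \<in> poly_ring N"
  shows "rename_vars \<tau> p \<in> poly_ring N"
  unfolding poly_ring_def mem_Collect_eq
proof
  fix e
  assume "e \<in> Poly_Mapping.keys (rename_vars \<tau> p)"
  then have "Poly_Mapping.map_key \<tau> e \<in> Poly_Mapping.keys p"
    by (simp add: rename_vars_def keys_map_key[OF inj_map_key[OF permutes_bij[OF assms(1)]]])
  then have "\<tau> -` Poly_Mapping.keys e \<subseteq> {1..N}"
    using assms(2)
    by (metis (no_types, lifting) keys_map_key mem_Collect_eq permutes_inj[OF assms(1)]
        poly_ring_def)
  then have "\<tau> ` (\<tau> -` Poly_Mapping.keys e) \<subseteq> \<tau> ` {1..N}"
    by (rule image_mono)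
  then show "Poly_Mapping.keys e \<subseteq> {1..N}"
    unfolding permutes_image[OF assms(1)] surj_image_vimage_eq[OF permutes_surj[OF assms(1)]] .
qed

lemma algebra_automorphism_rename_vars:
  assumes "\<tau> permutes {1..N}"
  shows "algebra_automorphism N (rename_vars \<tau> :: 'k::field polynomial \<Rightarrow> _)"
proof -
  note bij = permutes_bij[OF assms]
  have "bij_betw (rename_vars \<tau> :: 'k polynomial \<Rightarrow> _) (poly_ring N) (poly_ring N)"
  proof (rule bij_betwI)
    show "rename_vars \<tau> \<in> poly_ring N \<rightarrow> poly_ring N"
      "rename_vars (inv \<tau>) \<in> poly_ring N \<rightarrow> poly_ring N"
      using rename_vars_in_poly_ring assms permutes_inv[OF assms] by blast+
    show "rename_vars (inv \<tau>) (rename_vars \<tau> p) = p"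
      "rename_vars \<tau> (rename_vars (inv \<tau>) p) = p" for p :: "'k polynomial"
      using rename_vars_inverse[OF bij] rename_vars_inverse[OF bij_imp_bij_inv[OF bij]]
      by (simp_all add: inv_inv_eq[OF bij])
  qed
  moreover have "rename_vars \<tau> 1 = (1 :: 'k polynomial)"
    using rename_vars_const[OF bij, of "1::'k"] by (simp add: const_def)
  ultimately show ?thesis
    by (simp add: algebra_automorphism_def rename_vars_add[OF bij] rename_vars_mult[OF bij]
        rename_vars_const[OF bij])
qed

section \<open>Squarefree monomials\<close>

lemma prod_X:
  assumes "finite S"
  shows "(\<Prod>i\<in>S. X i :: 'k::field polynomial) =
    Poly_Mapping.single (\<Sum>i\<in>S. Poly_Mapping.single i 1) 1"
  using assms by (induction S rule: finite_induct) (simp_all add: X_def mult_single)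

lemma prod_X_inject:
  assumes "finite S" "finite S'"
    and "(\<Prod>i\<in>S. X i :: 'k::field polynomial) = (\<Prod>i\<in>S'. X i)"
  shows "S = S'"
proof -
  have lookup: "Poly_Mapping.lookup (\<Sum>i\<in>A. Poly_Mapping.single i (1::nat)) j =
      (if j \<in> A then 1 else 0)" if "finite A" for A j
    using that by (simp add: lookup_sum lookup_single when_def)
  have "(\<Sum>i\<in>S. Poly_Mapping.single i (1::nat)) = (\<Sum>i\<in>S'. Poly_Mapping.single i 1)"
    using assms by (metis prod_X exponents_single)
  then have "j \<in> S \<longleftrightarrow> j \<in> S'" for j
    using lookup[OF assms(1), of j] lookup[OF assms(2), of j] by (metis zero_neq_one)
  then show ?thesis by blast
qed

lemma X_in_poly_ring: "i \<in> {1..N} \<Longrightarrow> X i \<in> poly_ring N"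
  by (simp add: poly_ring_def X_def)

lemma prod_X_in_poly_ring:
  assumes "S \<subseteq> {1..N}"
  shows "(\<Prod>i\<in>S. X i) \<in> poly_ring N"
proof -
  have "Poly_Mapping.keys (\<Sum>i\<in>S. Poly_Mapping.single i (1::nat)) \<subseteq> {1..N}"
    using keys_sum[of "\<lambda>i. Poly_Mapping.single i (1::nat)" S] assms by auto
  then show ?thesis
    using finite_subset[OF assms] by (simp add: poly_ring_def prod_X)
qed

text \<open>
  An automorphism of \<open>poly_ring N\<close> is multiplicative only there, hence the bound on \<open>S\<close>: every
  partial product must stay in the ring.
\<close>

lemma algebra_automorphism_prod_X:
  assumes "algebra_automorphism N \<Phi>" and "\<tau> permutes {1..N}"
    and "\<forall>j \<in> {1..N}. \<Phi> (X j) = X (\<tau> j)" and "S \<subseteq> {1..N}"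
  shows "\<Phi> (\<Prod>i\<in>S. X i) = (\<Prod>i\<in>\<tau> ` S. X i)"
proof -
  have "finite S"
    using assms(4) finite_subset by blast
  then have "\<Phi> (\<Prod>i\<in>S. X i) = (\<Prod>i\<in>S. X (\<tau> i))"
    using assms(4)
  proof (induction S rule: finite_induct)
    case empty
    then show ?case using assms(1) by (simp add: algebra_automorphism_def)
  next
    case (insert j S)
    then have "\<Phi> (X j * (\<Prod>i\<in>S. X i)) = \<Phi> (X j) * \<Phi> (\<Prod>i\<in>S. X i)"
      using assms(1) X_in_poly_ring[of j N] prod_X_in_poly_ring[of S N]
      unfolding algebra_automorphism_def by blast
    then show ?case
      using insert assms(3) by simp
  qed
  also have "\<dots> = (\<Prod>i\<in>\<tau> ` S. X i)"
    using permutes_inj[OF assms(2)] by (subst prod.reindex) (auto intro: inj_on_subset)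
  finally show ?thesis .
qed

section \<open>Indices sorted by residue class\<close>

text \<open>
  Every index in \<open>{1..n * d}\<close> is \<open>kn + j\<close> for a unique residue representative \<open>j\<close> in \<open>{1..n}\<close> and a
  unique \<open>k < d\<close>. The representatives run from 1 to \<open>n\<close> because the variables are counted from 1, so
  this is division with remainder for \<open>kn + (j - 1)\<close>.
\<close>

lemma residue_decomposition_unique:
  fixes n :: nat
  assumes "k * n + j = k' * n + j'" "1 \<le> j" "j \<le> n" "1 \<le> j'" "j' \<le> n"
  shows "k = k'" and "j = j'"
proof -
  obtain i i' where i: "j = Suc i" "j' = Suc i'"
    using assms by (metis Suc_le_D One_nat_def)
  then have "k * n + i = k' * n + i'" "i < n" "i' < n"
    using assms by auto
  moreover from this have "(k * n + i) div n = k" "(k' * n + i') div n = k'"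
    by (metis add.right_neutral div_less div_mult_self3 less_nat_zero_code)+
  ultimately show "k = k'" by simp
  with assms(1) show "j = j'" by simp
qed

lemma residue_cong_unique:
  fixes n :: nat
  assumes "[k * n + j = k' * n + j'] (mod n)" "j \<in> {1..n}" "j' \<in> {1..n}"
  shows "j = j'"
proof -
  obtain q q' where "k * n + j + q * n = k' * n + j' + q' * n"
    using assms(1) by (metis cong_iff_lin_nat)
  then have "(k + q) * n + j = (k' + q') * n + j'"
    by (simp add: algebra_simps)
  then show ?thesis
    by (rule residue_decomposition_unique(2)) (use assms in auto)
qed

lemma bij_betw_residue_decomposition:
  fixes n d :: nat
  shows "bij_betw (\<lambda>(k, j). k * n + j) ({..<d} \<times> {1..n}) {1..n * d}"
proof (rule bij_betw_imageI)
  show "inj_on (\<lambda>(k, j). k * n + j) ({..<d} \<times> {1..n})"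
    by (auto simp: inj_on_def simp del: One_nat_def dest: residue_decomposition_unique)
  show "(\<lambda>(k, j). k * n + j) ` ({..<d} \<times> {1..n}) = {1..n * d}"
  proof (intro equalityI subsetI)
    fix q
    assume "q \<in> (\<lambda>(k, j). k * n + j) ` ({..<d} \<times> {1..n})"
    then obtain k j where "q = k * n + j" "k < d" "1 \<le> j" "j \<le> n" by auto
    moreover from this have "Suc k * n \<le> d * n"
      by (intro mult_right_mono) auto
    ultimately show "q \<in> {1..n * d}" by (simp add: mult.commute)
  next
    fix q
    assume q: "q \<in> {1..n * d}"
    then have "n > 0" by (cases n) auto
    define k where "k = (q - 1) div n"
    define j where "j = (q - 1) mod n + 1"
    have "q = k * n + j"
      using q by (simp add: k_def j_def)
    moreover have "k < d"
      using q by (auto simp: k_def less_mult_imp_div_less mult.commute)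
    moreover have "j \<in> {1..n}"
      using \<open>n > 0\<close> by (simp add: j_def Suc_leI)
    ultimately show "q \<in> (\<lambda>(k, j). k * n + j) ` ({..<d} \<times> {1..n})"
      by (auto intro!: image_eqI[of _ _ "(k, j)"])
  qed
qed

lemma residue_index_in_range:
  fixes n :: nat
  assumes "k < d" "j \<in> {1..n}"
  shows "k * n + j \<in> {1..n * d}"
  using bij_betw_apply[OF bij_betw_residue_decomposition[of n d], of "(k, j)"] assms by simp

lemma prod_residue_classes:
  fixes n :: nat
  assumes "\<And>j. finite (K j)"
  shows "(\<Prod>j = 1..n. \<Prod>k\<in>K j. f (k * n + j)) =
    (\<Prod>i\<in>(\<Union>j\<in>{1..n}. (\<lambda>k. k * n + j) ` K j). f i)"
proof -
  have "(\<Prod>i\<in>(\<Union>j\<in>{1..n}. (\<lambda>k. k * n + j) ` K j). f i) =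
      (\<Prod>j = 1..n. \<Prod>i\<in>(\<lambda>k. k * n + j) ` K j. f i)"
    by (rule prod.UNION_disjoint)
      (use assms in \<open>auto dest: residue_decomposition_unique
        simp del: One_nat_def\<close>)
  also have "\<dots> = (\<Prod>j = 1..n. \<Prod>k\<in>K j. f (k * n + j))"
  proof (rule prod.cong[OF refl])
    fix j
    assume "j \<in> {1..n}"
    then have "inj_on (\<lambda>k. k * n + j) (K j)"
      by (auto simp: inj_on_def)
    then show "(\<Prod>i\<in>(\<lambda>k. k * n + j) ` K j. f i) = (\<Prod>k\<in>K j. f (k * n + j))"
      by (simp add: prod.reindex)
  qed
  finally show ?thesis by simp
qed

text \<open>
  A map that keeps residues cannot mix the classes, so an equality between an image and another
  set splits into one equality for each class.
\<close>

lemma residue_preserving_image: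
  fixes n d :: nat
  assumes cong: "\<forall>q \<in> {1..n * d}. [\<tau> q = q] (mod n)"
    and K: "\<And>j. j \<in> {1..n} \<Longrightarrow> K j \<subseteq> {..<d}"
    and image: "\<tau> ` (\<Union>j\<in>{1..n}. (\<lambda>k. k * n + j) ` K j) = (\<Union>j\<in>{1..n}. (\<lambda>k. k * n + j) ` L j)"
    and j: "j \<in> {1..n}"
  shows "\<tau> ` (\<lambda>k. k * n + j) ` K j = (\<lambda>k. k * n + j) ` L j"
proof (intro equalityI subsetI)
  fix q
  assume "q \<in> \<tau> ` (\<lambda>k. k * n + j) ` K j"
  then obtain k where k: "k \<in> K j" "q = \<tau> (k * n + j)" by auto
  then have "q \<in> (\<Union>j\<in>{1..n}. (\<lambda>k. k * n + j) ` L j)"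
    using image j by blast
  then obtain k' j' where k': "j' \<in> {1..n}" "k' \<in> L j'" "q = k' * n + j'" by auto
  have "k * n + j \<in> {1..n * d}"
    by (rule residue_index_in_range) (use k(1) K[OF j] j in auto)
  then have "[k' * n + j' = k * n + j] (mod n)"
    using cong k(2) k'(3) by metis
  then have "j' = j"
    using residue_cong_unique j k'(1) by blast
  then show "q \<in> (\<lambda>k. k * n + j) ` L j"
    using k' by blast
next
  fix q
  assume q: "q \<in> (\<lambda>k. k * n + j) ` L j"
  then obtain k where k: "k \<in> L j" "q = k * n + j" by auto
  have "q \<in> \<tau> ` (\<Union>j\<in>{1..n}. (\<lambda>k. k * n + j) ` K j)"
    unfolding image using j q by blast
  then obtain k' j' where k': "j' \<in> {1..n}" "k' \<in> K j'" "q = \<tau> (k' * n + j')" by auto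
  have "k' * n + j' \<in> {1..n * d}"
    by (rule residue_index_in_range) (use k'(2) K[OF k'(1)] k'(1) in auto)
  then have "[k * n + j = k' * n + j'] (mod n)"
    using cong k(2) k'(3) by metis
  then have "j = j'"
    using residue_cong_unique j k'(1) by blast
  then show "q \<in> \<tau> ` (\<lambda>k. k * n + j) ` K j"
    using k' by blast
qed

section \<open>Chains of finite sets\<close>

text \<open>
  The enumeration is built from the end: its last element is chosen outside the largest proper
  subset of \<open>C\<close> in the chain, hence outside all of them, and is removed from \<open>C\<close>.
\<close>

lemma chain_enumeration:
  assumes "finite C" and "\<forall>A\<in>F. A \<subseteq> C" and "\<forall>A\<in>F. \<forall>B\<in>F. A \<subseteq> B \<or> B \<subseteq> A"
  shows "\<exists>g :: 'a \<Rightarrow> nat. bij_betw g C {..<card C} \<and> (\<forall>A\<in>F. g ` A = {..<card A})"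
  using assms
proof (induction "card C" arbitrary: C F)
  case 0
  then have "C = {}" "\<forall>A\<in>F. A = {}" by auto
  then show ?case by (intro exI[of _ "\<lambda>_. 0"]) (auto simp: bij_betw_def)
next
  case (Suc N)
  let ?F = "{A\<in>F. A \<noteq> C}"
  obtain c where c: "c \<in> C" "\<forall>A\<in>?F. c \<notin> A"
  proof (cases "?F = {}")
    case True
    have "C \<noteq> {}" using Suc.hyps(2) by auto
    with True show ?thesis using that by blast
  next
    case False
    have "finite ?F"
      by (rule finite_subset[of _ "Pow C"]) (use Suc.prems in auto)
    from finite_has_maximal[OF this False]
    obtain M where M: "M \<in> ?F" "\<forall>A\<in>?F. M \<subseteq> A \<longrightarrow> M = A" by auto
    then have "\<forall>A\<in>?F. A \<subseteq> M" using Suc.prems(3) by blast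
    moreover obtain c where "c \<in> C" "c \<notin> M"
      using M(1) Suc.prems(2) by blast
    ultimately show ?thesis using that by blast
  qed
  have card: "card (C - {c}) = N"
    using c(1) Suc.hyps(2) Suc.prems(1) by simp
  have "\<exists>g :: 'a \<Rightarrow> nat. bij_betw g (C - {c}) {..<card (C - {c})} \<and> (\<forall>A\<in>?F. g ` A = {..<card A})"
    by (rule Suc.hyps(1)) (use card Suc.prems c(2) in auto)
  then obtain g :: "'a \<Rightarrow> nat" where
    g: "bij_betw g (C - {c}) {..<N}" "\<forall>A\<in>?F. g ` A = {..<card A}"
    using card by auto
  have "bij_betw (g(c := N)) (C - {c}) {..<N}"
    using g(1) by (subst bij_betw_cong[of _ _ g]) auto
  then have "bij_betw (g(c := N)) ((C - {c}) \<union> {c}) ({..<N} \<union> {N})"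
    by (rule bij_betw_combine) auto
  moreover have "(C - {c}) \<union> {c} = C" "{..<N} \<union> {N} = {..<card C}"
    using c(1) Suc.hyps(2) by auto
  ultimately have bij: "bij_betw (g(c := N)) C {..<card C}" by simp
  have "(g(c := N)) ` A = {..<card A}" if "A \<in> F" for A
  proof (cases "A = C")
    case True
    then show ?thesis using bij by (simp add: bij_betw_def)
  next
    case False
    then have "c \<notin> A" "g ` A = {..<card A}" using that c(2) g(2) by auto
    then show ?thesis by auto
  qed
  with bij show ?case by blast
qed

lemma card_Int_eq_min_iff_nested:
  assumes "finite A" "finite B"
  shows "card (A \<inter> B) = min (card A) (card B) \<longleftrightarrow> A \<subseteq> B \<or> B \<subseteq> A"
proof
  assume "card (A \<inter> B) = min (card A) (card B)"
  then have "card (A \<inter> B) = card A \<or> card (A \<inter> B) = card B" by linarith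
  then have "A \<inter> B = A \<or> A \<inter> B = B"
    using assms by (metis card_subset_eq inf_le1 inf_le2)
  then show "A \<subseteq> B \<or> B \<subseteq> A" by blast
next
  assume "A \<subseteq> B \<or> B \<subseteq> A"
  then show "card (A \<inter> B) = min (card A) (card B)"
    using assms by (auto simp: inf_absorb1 inf_absorb2 card_mono min_absorb1 min_absorb2)
qed

section \<open>Iterated spreading and polarization\<close>

text \<open>
  The positions, counted from 0, of the index \<open>j\<close> in the sorted index list of the monomial with
  exponents \<open>b\<close>.
\<close>

definition block :: "(nat \<Rightarrow> nat) \<Rightarrow> nat \<Rightarrow> nat set" where
  "block b j = {(\<Sum>l = 1..<j. b l) ..< (\<Sum>l = 1..j. b l)}"

lemma A_set_block: "A_set n b j = (\<lambda>k. k * n + j) ` block b j"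
  by (simp add: A_set_def block_def)

lemma card_block: "j \<ge> 1 \<Longrightarrow> card (block b j) = b j"
  by (simp add: block_def atLeastLessThanSuc_atLeastAtMost[symmetric])

lemma block_subset:
  assumes "j \<le> n"
  shows "block b j \<subseteq> {..<\<Sum>l = 1..n. b l}"
proof -
  have "(\<Sum>l = 1..j. b l) \<le> (\<Sum>l = 1..n. b l)"
    by (rule sum_mono2) (use assms in auto)
  then show ?thesis by (auto simp: block_def)
qed

lemma sigma_prod_list:
  assumes "sorted xs"
  shows "\<sigma> (prod_list (map X xs) :: 'k::field polynomial) =
    prod_list (map X (map (\<lambda>k. xs ! k + k) [0..<length xs]))"
  unfolding \<sigma>_def index_list_prod[OF assms]
  by (simp add: prod.distinct_set_conv_list[symmetric] comp_def lessThan_atLeast0)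

text \<open>
  Spreading keeps the list of indices sorted, so each application of \<open>\<sigma>\<close> shifts the same position
  \<open>k\<close> by another \<open>k\<close>.
\<close>

lemma sigma_power_prod_list:
  assumes "sorted xs"
  shows "(\<sigma> ^^ t) (prod_list (map X xs) :: 'k::field polynomial) =
    prod_list (map X (map (\<lambda>k. xs ! k + t * k) [0..<length xs]))"
proof (induction t)
  case 0
  then show ?case by (simp add: map_nth)
next
  case (Suc t)
  let ?ys = "map (\<lambda>k. xs ! k + t * k) [0..<length xs]"
  have "sorted ?ys"
    using assms by (auto simp: sorted_iff_nth_mono intro!: add_mono)
  then have "(\<sigma> ^^ Suc t) (prod_list (map X xs) :: 'k polynomial) =
      prod_list (map X (map (\<lambda>k. ?ys ! k + k) [0..<length ?ys]))"
    using Suc sigma_prod_list[of ?ys] by simp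
  also have "map (\<lambda>k. ?ys ! k + k) [0..<length ?ys] = map (\<lambda>k. xs ! k + Suc t * k) [0..<length xs]"
    by (auto simp: algebra_simps)
  finally show ?case .
qed

definition indices_upto :: "nat \<Rightarrow> (nat \<Rightarrow> nat) \<Rightarrow> nat list" where
  "indices_upto n b = concat (map (\<lambda>j. replicate (b j) j) [1..<Suc n])"

lemma indices_upto_Suc:
  "indices_upto (Suc n) b = indices_upto n b @ replicate (b (Suc n)) (Suc n)"
  by (simp add: indices_upto_def)

lemma length_indices_upto: "length (indices_upto n b) = (\<Sum>l = 1..n. b l)"
  by (induction n) (simp_all add: indices_upto_Suc, simp add: indices_upto_def)

lemma set_indices_upto: "set (indices_upto n b) \<subseteq> {1..n}"
  by (auto simp: indices_upto_def)

lemma sorted_indices_upto: "sorted (indices_upto n b)"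
proof (induction n)
  case 0
  show ?case by (simp add: indices_upto_def)
next
  case (Suc n)
  then show ?case
    using set_indices_upto[of n b] by (auto simp: indices_upto_Suc sorted_append)
qed

lemma prod_list_indices_upto:
  "prod_list (map X (indices_upto n b)) = (\<Prod>j = 1..n. X j ^ b j :: 'k::field polynomial)"
proof (induction n)
  case 0
  show ?case by (simp add: indices_upto_def)
next
  case (Suc n)
  then show ?case by (simp add: indices_upto_Suc)
qed

text \<open>
  This replaces the position \<open>k\<close> in the index list by the pair of the entry \<open>j\<close> and a position in its
  block. The function \<open>f\<close> may use both the entry and the position, as the shifted variable
  \<open>x\<^bsub>j + nk\<^esub>\<close> does.
\<close>

lemma prod_indices_upto:
  "(\<Prod>k<length (indices_upto n b). f (indices_upto n b ! k) k) =
   (\<Prod>j = 1..n. \<Prod>k\<in>block b j. f j k)"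
proof (induction n)
  case 0
  then show ?case by (simp add: indices_upto_def)
next
  case (Suc n)
  let ?xs = "indices_upto n b"
  let ?s = "length ?xs"
  have s: "?s = (\<Sum>l = 1..n. b l)"
    by (rule length_indices_upto)
  have block: "block b (Suc n) = {?s..<?s + b (Suc n)}"
    by (simp add: block_def s atLeastLessThanSuc_atLeastAtMost)
  have "(\<Prod>k<?s + b (Suc n). f (indices_upto (Suc n) b ! k) k) =
      (\<Prod>k<?s. f (indices_upto (Suc n) b ! k) k) *
      (\<Prod>k = ?s..<?s + b (Suc n). f (indices_upto (Suc n) b ! k) k)"
    by (simp add: lessThan_atLeast0 prod.atLeastLessThan_concat)
  also have "(\<Prod>k<?s. f (indices_upto (Suc n) b ! k) k) = (\<Prod>k<?s. f (?xs ! k) k)"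
    by (simp add: indices_upto_Suc nth_append)
  also have "(\<Prod>k = ?s..<?s + b (Suc n). f (indices_upto (Suc n) b ! k) k) =
      (\<Prod>k = ?s..<?s + b (Suc n). f (Suc n) k)"
    by (rule prod.cong) (auto simp: indices_upto_Suc nth_append)
  finally show ?case
    using Suc by (simp add: block) (simp add: indices_upto_Suc)
qed

lemma sigma_power_monomial:
  "(\<sigma> ^^ n) (\<Prod>j = 1..n. X j ^ b j :: 'k::field polynomial) =
   (\<Prod>i\<in>(\<Union>j\<in>{1..n}. A_set n b j). X i)"
proof -
  let ?xs = "indices_upto n b"
  have "(\<sigma> ^^ n) (\<Prod>j = 1..n. X j ^ b j :: 'k polynomial) =
      (\<Prod>k<length ?xs. X (?xs ! k + n * k))"
    unfolding prod_list_indices_upto[symmetric] sigma_power_prod_list[OF sorted_indices_upto]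
    by (simp add: prod.distinct_set_conv_list[symmetric] comp_def lessThan_atLeast0)
  also have "\<dots> = (\<Prod>j = 1..n. \<Prod>k\<in>block b j. X (k * n + j))"
    by (subst prod_indices_upto[where f = "\<lambda>j k. X (j + n * k)"]) (simp add: algebra_simps)
  also have "\<dots> = (\<Prod>i\<in>(\<Union>j\<in>{1..n}. A_set n b j). X i)"
    unfolding A_set_block by (rule prod_residue_classes) (simp add: block_def)
  finally show ?thesis .
qed

lemma exponents_monomial:
  "exponents (\<Prod>j = 1..n. X j ^ b j :: 'k::field polynomial) =
   (\<Sum>j = 1..n. Poly_Mapping.single j (b j))"
proof -
  have power: "(X j :: 'k polynomial) ^ c = Poly_Mapping.single (Poly_Mapping.single j c) 1" for j c
    by (induction c) (simp_all add: X_def mult_single single_add[symmetric])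
  have "(\<Prod>j = 1..n. X j ^ b j :: 'k polynomial) =
      Poly_Mapping.single (\<Sum>j = 1..n. Poly_Mapping.single j (b j)) 1"
    by (induction n) (simp_all add: power mult_single add.commute)
  then show ?thesis
    by (simp add: exponents_single)
qed

lemma exponent_monomial:
  "exponent (\<Prod>j = 1..n. X j ^ b j :: 'k::field polynomial) j = (if j \<in> {1..n} then b j else 0)"
  unfolding exponent_def exponents_monomial by (simp add: lookup_sum lookup_single when_def)

lemma monomial_degree_monomial:
  "monomial_degree (\<Prod>j = 1..n. X j ^ b j :: 'k::field polynomial) = (\<Sum>j = 1..n. b j)"
proof -
  let ?u = "\<Prod>j = 1..n. X j ^ b j :: 'k polynomial"
  have "Poly_Mapping.keys (exponents ?u) \<subseteq> {1..n}"
    using exponent_monomial[where n = n and b = b and 'k = 'k]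
    by (auto simp: in_keys_iff exponent_def split: if_splits)
  then have "monomial_degree ?u = (\<Sum>j = 1..n. exponent ?u j)"
    unfolding monomial_degree_def
    by (intro sum.mono_neutral_left) (auto simp: in_keys_iff exponent_def)
  then show ?thesis unfolding exponent_monomial by simp
qed

lemma polarization_monomial:
  "polarization n (\<Prod>j = 1..n. X j ^ b j :: 'k::field polynomial) =
   (\<Prod>i\<in>(\<Union>j\<in>{1..n}. (\<lambda>k. k * n + j) ` {..<b j}). X i)"
proof -
  have "polarization n (\<Prod>j = 1..n. X j ^ b j :: 'k polynomial) =
      (\<Prod>j = 1..n. \<Prod>k\<in>{..<b j}. X (k * n + j))"
    unfolding polarization_def exponent_monomial by (rule prod.cong) simp_all
  also have "\<dots> = (\<Prod>i\<in>(\<Union>j\<in>{1..n}. (\<lambda>k. k * n + j) ` {..<b j}). X i)"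
    by (rule prod_residue_classes) simp
  finally show ?thesis .
qed

section \<open>The combinatorial form of smooth spreadability\<close>

text \<open>
  The degree bound keeps all blocks below \<open>d\<close>, so that the indices of \<open>\<sigma>\<^sup>n(u)\<close> lie in \<open>{1..n * d}\<close>,
  where \<open>\<Phi>\<close> and \<open>\<tau>\<close> are controlled. A squarefree monomial determines its index set, which turns the
  equation between monomials into one between sets, and this one splits into residue classes.
\<close>

lemma spread_to_polarization_iff:
  fixes \<Phi> :: "'k::field polynomial \<Rightarrow> 'k polynomial"
  assumes "algebra_automorphism (n * d) \<Phi>" and "\<tau> permutes {1..n * d}"
    and "\<forall>j \<in> {1..n * d}. \<Phi> (X j) = X (\<tau> j)"
    and cong: "\<forall>j \<in> {1..n * d}. [\<tau> j = j] (mod n)"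
    and "(\<Sum>j = 1..n. b j) \<le> d"
  shows "\<Phi> ((\<sigma> ^^ n) (\<Prod>j = 1..n. X j ^ b j)) = polarization n (\<Prod>j = 1..n. X j ^ b j) \<longleftrightarrow>
    (\<forall>j \<in> {1..n}. \<tau> ` A_set n b j = (\<lambda>k. k * n + j) ` {..<b j})"
proof -
  let ?S = "\<Union>j\<in>{1..n}. A_set n b j"
  let ?P = "\<Union>j\<in>{1..n}. (\<lambda>k. k * n + j) ` {..<b j}"
  have block: "block b j \<subseteq> {..<d}" if "j \<in> {1..n}" for j
    using block_subset[of j n b] that assms(5) by auto
  have "?S \<subseteq> {1..n * d}"
    unfolding A_set_block using block residue_index_in_range by blast
  then have "\<Phi> ((\<sigma> ^^ n) (\<Prod>j = 1..n. X j ^ b j)) = (\<Prod>i\<in>\<tau> ` ?S. X i)"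
    unfolding sigma_power_monomial using algebra_automorphism_prod_X assms by blast
  then have "\<Phi> ((\<sigma> ^^ n) (\<Prod>j = 1..n. X j ^ b j)) = polarization n (\<Prod>j = 1..n. X j ^ b j) \<longleftrightarrow>
      (\<Prod>i\<in>\<tau> ` ?S. X i :: 'k polynomial) = (\<Prod>i\<in>?P. X i)"
    by (simp only: polarization_monomial)
  also have "\<dots> \<longleftrightarrow> \<tau> ` ?S = ?P"
  proof
    assume "(\<Prod>i\<in>\<tau> ` ?S. X i :: 'k polynomial) = (\<Prod>i\<in>?P. X i)"
    then show "\<tau> ` ?S = ?P"
      by (rule prod_X_inject[rotated 2]) (simp_all add: A_set_def)
  qed simp
  also have "\<dots> \<longleftrightarrow> (\<forall>j \<in> {1..n}. \<tau> ` A_set n b j = (\<lambda>k. k * n + j) ` {..<b j})"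
  proof
    assume "\<tau> ` ?S = ?P"
    then show "\<forall>j \<in> {1..n}. \<tau> ` A_set n b j = (\<lambda>k. k * n + j) ` {..<b j}"
      unfolding A_set_block
      using residue_preserving_image[where K = "block b" and L = "\<lambda>j. {..<b j}", OF cong block]
      by blast
  qed (simp add: image_UN)
  finally show ?thesis .
qed

text \<open>
  The permutations \<open>g j\<close> act on the pairs \<open>(k, j)\<close>, and the bijection \<open>(k, j) \<mapsto> kn + j\<close> transports this
  action to \<open>{1..n * d}\<close>.
\<close>

lemma blockwise_permutation:
  fixes n d :: nat
  assumes g: "\<And>j. j \<in> {1..n} \<Longrightarrow> bij_betw (g j) {..<d} {..<d}"
  obtains \<tau> where "\<tau> permutes {1..n * d}"
    and "\<And>j k. j \<in> {1..n} \<Longrightarrow> k < d \<Longrightarrow> \<tau> (k * n + j) = g j k * n + j"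
proof -
  let ?D = "{..<d} \<times> {1..n}"
  let ?e = "\<lambda>(k, j). k * n + j"
  let ?h = "\<lambda>(k, j). (g j k, j)"
  let ?\<rho> = "?e \<circ> (?h \<circ> inv_into ?D ?e)"
  note e = bij_betw_residue_decomposition[of n d]
  have "bij_betw ?h ?D ?D"
  proof (rule bij_betw_imageI)
    show "inj_on ?h ?D"
      using g by (fastforce simp: inj_on_def bij_betw_def)
    show "?h ` ?D = ?D"
    proof (intro equalityI subsetI)
      fix x assume "x \<in> ?h ` ?D"
      then show "x \<in> ?D" using g by (fastforce dest: bij_betwE)
    next
      fix x assume "x \<in> ?D"
      then obtain k j where x: "x = (k, j)" "k \<in> {..<d}" "j \<in> {1..n}" by auto
      then have "k \<in> g j ` {..<d}"
        using g by (simp add: bij_betw_def)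
      then obtain k' where "k' \<in> {..<d}" "k = g j k'" by blast
      then show "x \<in> ?h ` ?D"
        using x by (auto intro!: image_eqI[of _ _ "(k', j)"])
    qed
  qed
  then have \<rho>: "bij_betw ?\<rho> {1..n * d} {1..n * d}"
    by (rule bij_betw_trans[OF bij_betw_trans[OF bij_betw_inv_into[OF e]] e])
  let ?\<tau> = "\<lambda>q. if q \<in> {1..n * d} then ?\<rho> q else q"
  show thesis
  proof
    have "bij_betw ?\<tau> {1..n * d} {1..n * d}"
      using \<rho> by (subst bij_betw_cong[of _ _ ?\<rho>]) auto
    then show "?\<tau> permutes {1..n * d}"
      by (rule bij_imp_permutes) auto
    fix j k
    assume jk: "j \<in> {1..n}" "k < d"
    then have "inv_into ?D ?e (?e (k, j)) = (k, j)"
      by (intro inv_into_f_f bij_betw_imp_inj_on[OF e]) auto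
    then show "?\<tau> (k * n + j) = g j k * n + j"
      using residue_index_in_range[OF jk(2,1)] by simp
  qed
qed

lemma card_A_set_Int:
  assumes "n \<ge> 1"
  shows "card (A_set n b j \<inter> A_set n b' j) = card (block b j \<inter> block b' j)"
proof -
  have inj: "inj (\<lambda>k. k * n + j)"
    using assms by (auto simp: inj_def)
  then have "A_set n b j \<inter> A_set n b' j = (\<lambda>k. k * n + j) ` (block b j \<inter> block b' j)"
    by (simp add: A_set_block image_Int)
  then show ?thesis
    using inj by (simp add: card_image inj_on_subset)
qed

text \<open>
  A permutation preserves the size of intersections, and initial segments meet in the shorter one.
  Conversely, the cardinality condition says that the blocks of each fixed \<open>j\<close> form a chain
  of subsets of \<open>{..<d}\<close>, and an enumeration of \<open>{..<d}\<close> along this chain is the required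
  permutation of the class of \<open>j\<close>.
\<close>

lemma straightening_permutation_iff:
  assumes "n \<ge> 1"
    and d: "\<And>i. i \<in> I \<Longrightarrow> (\<Sum>j = 1..n. a i j) \<le> d"
  shows "(\<exists>\<tau>. \<tau> permutes {1..n * d} \<and> (\<forall>j \<in> {1..n * d}. [\<tau> j = j] (mod n)) \<and>
      (\<forall>i \<in> I. \<forall>j \<in> {1..n}. \<tau> ` A_set n (a i) j = (\<lambda>k. k * n + j) ` {..<a i j})) \<longleftrightarrow>
    (\<forall>i \<in> I. \<forall>l \<in> I. \<forall>j \<in> {1..n}.
      card (A_set n (a i) j \<inter> A_set n (a l) j) = min (a i j) (a l j))"
    (is "?straight \<longleftrightarrow> ?nested")
proof
  assume ?straight
  then obtain \<tau> where \<tau>: "\<tau> permutes {1..n * d}"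
    "\<forall>i \<in> I. \<forall>j \<in> {1..n}. \<tau> ` A_set n (a i) j = (\<lambda>k. k * n + j) ` {..<a i j}" by blast
  show ?nested
  proof (intro ballI)
    fix i l j
    assume ilj: "i \<in> I" "l \<in> I" "j \<in> {1..n}"
    have inj: "inj (\<lambda>k. k * n + j)"
      using assms(1) by (auto simp: inj_def)
    have "card (A_set n (a i) j \<inter> A_set n (a l) j) =
        card (\<tau> ` (A_set n (a i) j \<inter> A_set n (a l) j))"
      using permutes_inj[OF \<tau>(1)] by (metis card_image inj_on_subset subset_UNIV)
    also have "\<dots> = card ((\<lambda>k. k * n + j) ` ({..<a i j} \<inter> {..<a l j}))"
      using \<tau>(2) ilj by (simp add: image_Int[OF permutes_inj[OF \<tau>(1)]] image_Int[OF inj])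
    also have "\<dots> = min (a i j) (a l j)"
    proof -
      have "{..<a i j} \<inter> {..<a l j} = {..<min (a i j) (a l j)}" by auto
      then show ?thesis
        using inj by (simp add: card_image inj_on_subset)
    qed
    finally show "card (A_set n (a i) j \<inter> A_set n (a l) j) = min (a i j) (a l j)" .
  qed
next
  assume nested: ?nested
  have block: "block (a i) j \<subseteq> {..<d}" if "i \<in> I" "j \<in> {1..n}" for i j
    using block_subset[of j n "a i"] d[OF that(1)] that(2) by auto
  have "\<exists>g. bij_betw g {..<d} {..<d} \<and> (\<forall>i\<in>I. g ` block (a i) j = {..<a i j})"
    if j: "j \<in> {1..n}" for j
  proof -
    have "\<forall>A\<in>(\<lambda>i. block (a i) j) ` I. \<forall>B\<in>(\<lambda>i. block (a i) j) ` I. A \<subseteq> B \<or> B \<subseteq> A"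
    proof (intro ballI, elim imageE, hypsubst)
      fix i l
      assume "i \<in> I" "l \<in> I"
      then have "card (block (a i) j \<inter> block (a l) j) = min (card (block (a i) j)) (card (block (a l) j))"
        using nested j card_A_set_Int[OF assms(1)] card_block by simp
      then show "block (a i) j \<subseteq> block (a l) j \<or> block (a l) j \<subseteq> block (a i) j"
        by (subst (asm) card_Int_eq_min_iff_nested) (simp_all add: block_def)
    qed
    then show ?thesis
      using chain_enumeration[of "{..<d}" "(\<lambda>i. block (a i) j) ` I"] block j card_block by simp
  qed
  then obtain g where g: "\<And>j. j \<in> {1..n} \<Longrightarrow> bij_betw (g j) {..<d} {..<d}"
    "\<And>i j. j \<in> {1..n} \<Longrightarrow> i \<in> I \<Longrightarrow> g j ` block (a i) j = {..<a i j}"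
    by metis
  obtain \<tau> where \<tau>: "\<tau> permutes {1..n * d}"
    "\<And>j k. j \<in> {1..n} \<Longrightarrow> k < d \<Longrightarrow> \<tau> (k * n + j) = g j k * n + j"
    using blockwise_permutation[of n g d, OF g(1)] by blast
  have "[\<tau> q = q] (mod n)" if "q \<in> {1..n * d}" for q
  proof -
    have "q \<in> (\<lambda>(k, j). k * n + j) ` ({..<d} \<times> {1..n})"
      using that unfolding bij_betw_imp_surj_on[OF bij_betw_residue_decomposition] .
    then obtain k j where "j \<in> {1..n}" "k < d" "q = k * n + j" by auto
    then show ?thesis using \<tau>(2) by (simp add: cong_def)
  qed
  moreover have "\<tau> ` A_set n (a i) j = (\<lambda>k. k * n + j) ` {..<a i j}"
    if ij: "i \<in> I" "j \<in> {1..n}" for i j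
  proof -
    have "\<tau> ` A_set n (a i) j = (\<lambda>k. g j k * n + j) ` block (a i) j"
      unfolding A_set_block image_image
      by (rule image_cong) (use \<tau>(2) block[OF ij] ij in auto)
    also have "\<dots> = (\<lambda>k. k * n + j) ` g j ` block (a i) j"
      by (simp add: image_image)
    finally show ?thesis
      using g(2) ij by simp
  qed
  ultimately show ?straight
    using \<tau>(1) by blast
qed

theorem theorem1p18:
  fixes n m d :: nat
    and u :: "nat \<Rightarrow> 'k::field polynomial"
    and a :: "nat \<Rightarrow> nat \<Rightarrow> nat"
  assumes "n \<ge> 1" and "m \<ge> 1" and "d > 0"
    and "\<forall>i \<in> {1..m}. u i = (\<Prod>j = 1..n. X j ^ a i j)"
    and "\<forall>i \<in> {1..m}. monomial_degree (u i) \<le> d"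
  shows "smoothly_spreadable n d (u ` {1..m}) \<longleftrightarrow>
    (\<forall>i l j. 1 \<le> i \<and> i < l \<and> l \<le> m \<and> 1 \<le> j \<and> j \<le> n \<longrightarrow>
       min (a i j) (a l j) = card (A_set n (a i) j \<inter> A_set n (a l) j))"
proof -
  have d: "(\<Sum>j = 1..n. a i j) \<le> d" if "i \<in> {1..m}" for i
    using assms(4,5) that by (metis monomial_degree_monomial)
  let ?straight = "\<lambda>\<tau>. \<forall>i \<in> {1..m}. \<forall>j \<in> {1..n}.
    \<tau> ` A_set n (a i) j = (\<lambda>k. k * n + j) ` {..<a i j}"
  have monomials: "(\<forall>v \<in> u ` {1..m}. \<Phi> ((\<sigma> ^^ n) v) = polarization n v) \<longleftrightarrow> ?straight \<tau>"
    if "algebra_automorphism (n * d) \<Phi>" "\<tau> permutes {1..n * d}"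
      "\<forall>j \<in> {1..n * d}. \<Phi> (X j) = X (\<tau> j)" "\<forall>j \<in> {1..n * d}. [\<tau> j = j] (mod n)" for \<Phi> \<tau>
    using spread_to_polarization_iff[OF that d] assms(4) by simp
  have "smoothly_spreadable n d (u ` {1..m}) \<longleftrightarrow>
    (\<exists>\<tau>. \<tau> permutes {1..n * d} \<and> (\<forall>j \<in> {1..n * d}. [\<tau> j = j] (mod n)) \<and> ?straight \<tau>)"
  proof
    assume "smoothly_spreadable n d (u ` {1..m})"
    then obtain \<tau> \<Phi> where \<tau>: "\<tau> permutes {1..n * d}" "\<forall>j \<in> {1..n * d}. [\<tau> j = j] (mod n)"
      and \<Phi>: "algebra_automorphism (n * d) \<Phi>" "\<forall>j \<in> {1..n * d}. \<Phi> (X j) = X (\<tau> j)"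
        "\<forall>v \<in> u ` {1..m}. \<Phi> ((\<sigma> ^^ n) v) = polarization n v"
      unfolding smoothly_spreadable_def by blast
    then have "?straight \<tau>"
      using monomials[OF \<Phi>(1) \<tau>(1) \<Phi>(2) \<tau>(2)] by blast
    with \<tau> show "\<exists>\<tau>. \<tau> permutes {1..n * d} \<and> (\<forall>j \<in> {1..n * d}. [\<tau> j = j] (mod n)) \<and> ?straight \<tau>"
      by blast
  next
    assume "\<exists>\<tau>. \<tau> permutes {1..n * d} \<and> (\<forall>j \<in> {1..n * d}. [\<tau> j = j] (mod n)) \<and> ?straight \<tau>"
    then obtain \<tau> where \<tau>: "\<tau> permutes {1..n * d}" "\<forall>j \<in> {1..n * d}. [\<tau> j = j] (mod n)"
      "?straight \<tau>" by blast
    have aut: "algebra_automorphism (n * d) (rename_vars \<tau> :: 'k polynomial \<Rightarrow> _)"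
      by (rule algebra_automorphism_rename_vars[OF \<tau>(1)])
    have X: "\<forall>j \<in> {1..n * d}. rename_vars \<tau> (X j :: 'k polynomial) = X (\<tau> j)"
      by (simp add: rename_vars_X[OF permutes_bij[OF \<tau>(1)]])
    have "\<forall>v \<in> u ` {1..m}. rename_vars \<tau> ((\<sigma> ^^ n) v) = polarization n v"
      using monomials[OF aut \<tau>(1) X \<tau>(2)] \<tau>(3) by blast
    then show "smoothly_spreadable n d (u ` {1..m})"
      unfolding smoothly_spreadable_def using \<tau>(1,2) aut X by blast
  qed
  also have "\<dots> \<longleftrightarrow> (\<forall>i \<in> {1..m}. \<forall>l \<in> {1..m}. \<forall>j \<in> {1..n}.
      card (A_set n (a i) j \<inter> A_set n (a l) j) = min (a i j) (a l j))"
    by (rule straightening_permutation_iff[OF assms(1) d])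
  also have "\<dots> \<longleftrightarrow> (\<forall>i l j. 1 \<le> i \<and> i < l \<and> l \<le> m \<and> 1 \<le> j \<and> j \<le> n \<longrightarrow>
       min (a i j) (a l j) = card (A_set n (a i) j \<inter> A_set n (a l) j))"
    (is "_ \<longleftrightarrow> ?ordered")
  proof
    assume ordered: ?ordered
    \<comment> \<open>The condition is symmetric in \<open>i\<close> and \<open>l\<close>, and on the diagonal it only counts a block.\<close>
    show "\<forall>i \<in> {1..m}. \<forall>l \<in> {1..m}. \<forall>j \<in> {1..n}.
      card (A_set n (a i) j \<inter> A_set n (a l) j) = min (a i j) (a l j)"
    proof (intro ballI)
      fix i l j
      assume ilj: "i \<in> {1..m}" "l \<in> {1..m}" "j \<in> {1..n}"
      consider "i < l" | "l < i" | "i = l" by linarith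
      then show "card (A_set n (a i) j \<inter> A_set n (a l) j) = min (a i j) (a l j)"
      proof cases
        case 1
        then show ?thesis using ordered ilj by simp
      next
        case 2
        then have "min (a l j) (a i j) = card (A_set n (a l) j \<inter> A_set n (a i) j)"
          using ordered ilj by simp
        then show ?thesis by (simp only: Int_commute min.commute)
      next
        case 3
        then show ?thesis
          using card_A_set_Int[OF assms(1), of "a i" j "a i"] card_block[of j "a i"] ilj by simp
      qed
    qed
  qed auto
  finally show ?thesis .
qed

end
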